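(* Let $f:\mathbb{R}^n\to\mathbb{R}$ be a twice differentiable, strictly convex function that is bounded from below and attains its minimum at some $x^*\in\mathbb{R}^n$, and suppose $f$ is strongly self-concordant with constant $M>0$. Suppose the sequence $(x_k)_{k\in\mathbb{N}}$ is generated by the pure Newton method $x_{k+1}=x_k-\nabla^2 f(x_k)^{-1}\nabla f(x_k)$. If $\lambda(x_k)\le\frac{131}{100M}$, then the method will converge quadratically. In particular, $$\lambda(x_{k+1})\le \frac{\sqrt{1+M\lambda(x_k)}}{2}\,M\lambda(x_k)^2\le \frac{\sqrt{1+\frac{131}{100}}}{2}\cdot\frac{131}{100}\,\lambda(x_k)<\lambda(x_k).$$
   Context: For $A,B\in\mathbb{R}^{n\times n}$, $A\preceq B$ means $x^T(B-A)x\ge 0$ for all $x\in\mathbb{R}^n$. The local norm at $z\in\mathbb{R}^n$ is $\|y\|_z=(y^T\nabla^2 f(z)y)^{1/2}$ and its dual is $\|y\|_z^*=(y^T\nabla^2 f(z)^{-1}y)^{1/2}$; these are taken to be well defined (Hessians invertible) by virtue of the strict convexity of $f$. The function $f$ is strongly self-concordant with constant $M>0$ if for all $x,y,z,w\in\mathbb{R}^n$, $\nabla^2 f(y)-\nabla^2 f(x)\preceq M\|x-y\|_z\nabla^2 f(w)$. The Newton decrement, i.e. the local norm of the gradient, is $\lambda(x)=[\nabla f(x)^T\nabla^2 f(x)^{-1}\nabla f(x)]^{1/2}$. The convergence of the method is measured in terms of $\lambda$.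
   Formalization: The final strict inequality is asserted only when λ(x_k) ≠ 0, since for λ(x_k) = 0 (that is, x_k = x* ) it would read 0 < 0; all other parts are stated without this condition. *)

theory Defs
  imports "HOL-Analysis.Analysis"
begin

definition gradient :: "(real^'n \<Rightarrow> real) \<Rightarrow> real^'n \<Rightarrow> real^'n" where
  "gradient f x = (THE D. GDERIV f x :> D)"

definition hessian :: "(real^'n \<Rightarrow> real) \<Rightarrow> real^'n \<Rightarrow> real^'n^'n" where
  "hessian f x = jacobian (gradient f) (at x)"

text \<open>Only differentiability of the gradient is asked for, not continuity of the Hessian.\<close>

definition twice_differentiable :: "(real^'n \<Rightarrow> real) \<Rightarrow> bool" where
  "twice_differentiable f \<longleftrightarrow>
     (\<forall>x. f differentiable (at x)) \<and> (\<forall>x. gradient f differentiable (at x))"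

definition strictly_convex :: "('a::real_vector \<Rightarrow> real) \<Rightarrow> bool" where
  "strictly_convex f \<longleftrightarrow>
     (\<forall>x y t. x \<noteq> y \<longrightarrow> 0 < t \<longrightarrow> t < 1 \<longrightarrow>
        f ((1 - t) *\<^sub>R x + t *\<^sub>R y) < (1 - t) * f x + t * f y)"

definition loewner_le :: "real^'n^'n \<Rightarrow> real^'n^'n \<Rightarrow> bool"  (infix "\<preceq>" 50) where
  "A \<preceq> B \<longleftrightarrow> (\<forall>x. 0 \<le> x \<bullet> ((B - A) *v x))"

definition local_norm :: "(real^'n \<Rightarrow> real) \<Rightarrow> real^'n \<Rightarrow> real^'n \<Rightarrow> real" where
  "local_norm f z y = sqrt (y \<bullet> (hessian f z *v y))"

text \<open>The constant \<^const>\<open>matrix_inv\<close> is total and is the inverse only for invertible matrices.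
  Invertibility is not imposed anywhere: if \<open>f\<close> is strictly convex and strongly self-concordant
  and \<open>v\<close> is in the kernel of one Hessian, then \<open>v \<bullet> (hessian f x *v v)\<close> vanishes for every \<open>x\<close>,
  so \<open>f\<close> is affine in the direction \<open>v\<close> and hence \<open>v = 0\<close>.\<close>

definition dual_local_norm :: "(real^'n \<Rightarrow> real) \<Rightarrow> real^'n \<Rightarrow> real^'n \<Rightarrow> real" where
  "dual_local_norm f z y = sqrt (y \<bullet> (matrix_inv (hessian f z) *v y))"

definition newton_decrement :: "(real^'n \<Rightarrow> real) \<Rightarrow> real^'n \<Rightarrow> real" where
  "newton_decrement f x = dual_local_norm f x (gradient f x)"

definition strongly_self_concordant :: "(real^'n \<Rightarrow> real) \<Rightarrow> real \<Rightarrow> bool" where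
  "strongly_self_concordant f M \<longleftrightarrow> M > 0 \<and>
     (\<forall>x y z w. hessian f y - hessian f x \<preceq> (M * local_norm f z (x - y)) *\<^sub>R hessian f w)"

definition newton_sequence :: "(real^'n \<Rightarrow> real) \<Rightarrow> (nat \<Rightarrow> real^'n) \<Rightarrow> bool" where
  "newton_sequence f x \<longleftrightarrow>
     (\<forall>k. x (Suc k) = x k - matrix_inv (hessian f (x k)) *v gradient f (x k))"

text \<open>Quadratic convergence of a sequence of nonnegative error measures.\<close>

definition converges_quadratically :: "(nat \<Rightarrow> real) \<Rightarrow> bool" where
  "converges_quadratically e \<longleftrightarrow>
     e \<longlonglongrightarrow> 0 \<and> (\<exists>C>0. \<forall>j. e (Suc j) \<le> C * (e j)\<^sup>2)"

end

theory Submission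
  imports Defs
begin

text \<open>
  Write \<open>H\<close> and \<open>H'\<close> for the Hessians at \<open>x\<close> and at the Newton iterate \<open>x' = x + d\<close>, and \<open>l\<close>, \<open>l'\<close> for
  the Newton decrements there.  Since \<open>H d\<close> is minus the gradient at \<open>x\<close>, the gradient at \<open>x'\<close> is the
  accumulated change of the Hessian along the step, the integral of \<open>(H\<^sub>t - H) d\<close> over \<open>t\<close> in \<open>[0, 1]\<close>,
  where \<open>H\<^sub>t\<close> is the Hessian at \<open>x + t d\<close>.  The local norm of \<open>d\<close> at \<open>x\<close> is \<open>l\<close>, so strong
  self-concordance bounds the quadratic form of \<open>H\<^sub>t - H\<close> in absolute value by \<open>M t l\<close> times that of any
  Hessian.  Taking \<open>H'\<close> as this reference Hessian and passing to the bilinear form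
  (\<open>hessian_difference_bilinear_le\<close>) gives \<open>l' \<le> M l / 2\<close> times the local norm of \<open>d\<close> at \<open>x'\<close>; one more
  use of self-concordance compares this norm with the one at \<open>x\<close>, at the price of the factor
  \<open>sqrt (1 + M l)\<close>.  This is \<open>newton_decrement_step\<close>, which holds for every \<open>x\<close>.  The threshold \<open>131/100\<close>
  enters only to make the resulting contraction factor smaller than one.

  The argument rests on two properties of the Hessian.  It is symmetric
  (\<open>hessian_symmetric\<close>); without symmetry its quadratic form would not control its
  bilinear form.  It is positive definite (\<open>hessian_pos\<close>), so that \<^const>\<open>matrix_inv\<close> really inverts it and
  the local norms are norms.
\<close>

section \<open>Derivatives along lines\<close>

lemma has_derivative_gradient:
  fixes f :: "real^'n \<Rightarrow> real"
  assumes "f differentiable (at x)"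
  shows "(f has_derivative (\<lambda>h. h \<bullet> gradient f x)) (at x)"
proof -
  obtain F where F: "(f has_derivative F) (at x)"
    using assms by (auto simp: differentiable_def)
  then have "linear F"
    by (rule has_derivative_linear)
  then have "F = (\<lambda>h. h \<bullet> adjoint F 1)"
    using adjoint_works[of F _ 1] by (auto simp: fun_eq_iff)
  with F have D: "GDERIV f x :> adjoint F 1"
    by (simp add: gderiv_def)
  have "GDERIV f x :> gradient f x"
    unfolding gradient_def
  proof (rule theI[where P = "\<lambda>D. GDERIV f x :> D", OF D])
    fix E assume "GDERIV f x :> E"
    with D have "(\<lambda>h. h \<bullet> E) = (\<lambda>h. h \<bullet> adjoint F 1)"
      unfolding gderiv_def by (metis has_derivative_unique)
    then show "E = adjoint F 1"
      by (metis inner_commute vector_eq_rdot)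
  qed
  then show ?thesis
    by (simp add: gderiv_def)
qed

lemma has_derivative_hessian:
  fixes f :: "real^'n \<Rightarrow> real"
  assumes "twice_differentiable f"
  shows "(gradient f has_derivative (\<lambda>h. hessian f x *v h)) (at x)"
  using assms jacobian_works unfolding twice_differentiable_def hessian_def by blast

lemma DERIV_line:
  fixes f :: "real^'n \<Rightarrow> real"
  assumes "twice_differentiable f"
  shows "((\<lambda>t. f (a + t *\<^sub>R v)) has_real_derivative v \<bullet> gradient f (a + t *\<^sub>R v)) (at t)"
proof -
  have "((\<lambda>t. a + t *\<^sub>R v) has_derivative (\<lambda>s. s *\<^sub>R v)) (at t)"
    by (auto intro!: derivative_eq_intros)
  from has_derivative_compose[OF this has_derivative_gradient] assms show ?thesis
    by (simp add: has_field_derivative_def twice_differentiable_def mult_commute_abs)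
qed

lemma DERIV_gradient_line:
  fixes f :: "real^'n \<Rightarrow> real"
  assumes "twice_differentiable f"
  shows "((\<lambda>t. w \<bullet> gradient f (a + t *\<^sub>R v)) has_real_derivative
            w \<bullet> (hessian f (a + t *\<^sub>R v) *v v)) (at t)"
proof -
  have "((\<lambda>t. a + t *\<^sub>R v) has_derivative (\<lambda>s. s *\<^sub>R v)) (at t)"
    by (auto intro!: derivative_eq_intros)
  from has_derivative_inner_right[OF has_derivative_compose[OF this has_derivative_hessian[OF assms]], of w]
  show ?thesis
    by (simp add: has_field_derivative_def mult_commute_abs matrix_vector_mult_scaleR)
qed

section \<open>Symmetry of the Hessian\<close>

text \<open>The second difference is symmetric in \<open>u\<close> and \<open>v\<close>, so this limit yields the symmetry of the Hessian.
  The mean value theorem is applied only in the direction \<open>v\<close>; it turns the difference into one of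
  gradients at two points near \<open>x\<close>, and these are expanded by differentiability of the gradient at
  \<open>x\<close> alone, because \<open>twice_differentiable\<close> provides no continuity of the Hessian.\<close>

lemma second_difference_tendsto:
  fixes f :: "real^'n \<Rightarrow> real"
  assumes f: "twice_differentiable f"
  shows "((\<lambda>s. (f (x + s *\<^sub>R u + s *\<^sub>R v) - f (x + s *\<^sub>R u) - f (x + s *\<^sub>R v) + f x) / s\<^sup>2)
            \<longlongrightarrow> v \<bullet> (hessian f x *v u)) (at_right 0)"
proof (rule tendstoI)
  fix e :: real assume "e > 0"
  define H where "H = hessian f x"
  \<comment> \<open>The gradient remainders at \<open>s u + z v\<close> and \<open>z v\<close>, with \<open>z < s\<close>, contribute an error of at most \<open>e' c\<close>.\<close>
  define c where "c = norm v * (norm u + 2 * norm v)"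
  have "c \<ge> 0" by (simp add: c_def)
  define e' where "e' = e / (c + 1)"
  have "e' > 0" using \<open>e > 0\<close> \<open>c \<ge> 0\<close> by (simp add: e'_def)
  then obtain d where "d > 0" and d: "\<And>y. norm (y - x) < d \<Longrightarrow>
      norm (gradient f y - gradient f x - H *v (y - x)) \<le> e' * norm (y - x)"
    using has_derivative_hessian[OF f, of x] unfolding has_derivative_at_alt H_def by metis
  define r where "r h = gradient f (x + h) - gradient f x - H *v h" for h
  have r: "norm (r h) \<le> e' * norm h" if "norm h < d" for h
    using d[of "x + h"] that by (simp add: r_def)
  define D where "D s = f (x + s *\<^sub>R u + s *\<^sub>R v) - f (x + s *\<^sub>R u) - f (x + s *\<^sub>R v) + f x" for s
  have main: "dist (D s / s\<^sup>2) (v \<bullet> (H *v u)) < e"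
    if "0 < s" and "s < d / (norm u + norm v + 1)" for s
  proof -
    have sd: "s * (norm u + norm v + 1) < d"
      using that by (simp add: pos_less_divide_eq add_nonneg_pos)
    obtain z where z: "0 < z" "z < s" and Dz:
      "D s = s * (v \<bullet> gradient f (x + s *\<^sub>R u + z *\<^sub>R v) - v \<bullet> gradient f (x + z *\<^sub>R v))"
    proof -
      have "\<exists>z>0. z < s \<and> (f (x + s *\<^sub>R u + s *\<^sub>R v) - f (x + s *\<^sub>R v))
              - (f (x + s *\<^sub>R u + 0 *\<^sub>R v) - f (x + 0 *\<^sub>R v))
            = (s - 0) * (v \<bullet> gradient f (x + s *\<^sub>R u + z *\<^sub>R v) - v \<bullet> gradient f (x + z *\<^sub>R v))"
        by (rule MVT2[OF \<open>0 < s\<close>]) (rule DERIV_diff; rule DERIV_line[OF f])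
      then show ?thesis using that by (auto simp: D_def algebra_simps)
    qed
    have "norm (s *\<^sub>R u + z *\<^sub>R v) \<le> s * norm u + s * norm v"
      using z \<open>0 < s\<close> by (intro norm_triangle_mono) (auto intro!: mult_right_mono)
    moreover have "norm (z *\<^sub>R v) \<le> s * norm v"
      using z by (auto intro!: mult_right_mono)
    moreover have "0 \<le> s * norm u" "s * (norm u + norm v + 1) = s * norm u + s * norm v + s"
      using \<open>0 < s\<close> by (auto simp: algebra_simps)
    ultimately have n1: "norm (s *\<^sub>R u + z *\<^sub>R v) \<le> s * (norm u + norm v)"
      and n2: "norm (z *\<^sub>R v) \<le> s * norm v"
      and l: "norm (s *\<^sub>R u + z *\<^sub>R v) < d" "norm (z *\<^sub>R v) < d"
      using sd \<open>0 < s\<close> unfolding distrib_left by linarith+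
    have "norm (r (s *\<^sub>R u + z *\<^sub>R v)) \<le> e' * (s * (norm u + norm v))"
      using r[OF l(1)] n1 \<open>e' > 0\<close> by (meson order_trans mult_left_mono less_imp_le)
    moreover have "norm (r (z *\<^sub>R v)) \<le> e' * (s * norm v)"
      using r[OF l(2)] n2 \<open>e' > 0\<close> by (meson order_trans mult_left_mono less_imp_le)
    ultimately have "norm (r (s *\<^sub>R u + z *\<^sub>R v) - r (z *\<^sub>R v)) \<le> e' * s * (norm u + 2 * norm v)"
      using norm_triangle_ineq4[of "r (s *\<^sub>R u + z *\<^sub>R v)" "r (z *\<^sub>R v)"] by (simp add: algebra_simps)
    then have "\<bar>v \<bullet> (r (s *\<^sub>R u + z *\<^sub>R v) - r (z *\<^sub>R v))\<bar> \<le> norm v * (e' * s * (norm u + 2 * norm v))"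
      by (meson Cauchy_Schwarz_ineq2 order_trans mult_left_mono norm_ge_zero)
    then have b: "\<bar>v \<bullet> (r (s *\<^sub>R u + z *\<^sub>R v) - r (z *\<^sub>R v))\<bar> \<le> e' * s * c"
      by (simp add: c_def algebra_simps)
    have "v \<bullet> (r (s *\<^sub>R u + z *\<^sub>R v) - r (z *\<^sub>R v))
        = v \<bullet> gradient f (x + s *\<^sub>R u + z *\<^sub>R v) - v \<bullet> gradient f (x + z *\<^sub>R v) - s * (v \<bullet> (H *v u))"
      by (simp add: r_def inner_diff_right inner_add_right matrix_vector_right_distrib
          matrix_vector_mult_scaleR add.assoc)
    also have "\<dots> = s * (D s / s\<^sup>2 - v \<bullet> (H *v u))"
      using \<open>0 < s\<close> by (simp add: Dz power2_eq_square field_simps)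
    finally have "\<bar>s * (D s / s\<^sup>2 - v \<bullet> (H *v u))\<bar> \<le> e' * s * c"
      using b by (simp only:)
    then have "s * \<bar>D s / s\<^sup>2 - v \<bullet> (H *v u)\<bar> \<le> s * (e' * c)"
      using \<open>0 < s\<close> by (simp only: abs_mult abs_of_pos mult.assoc mult.left_commute)
    then have "\<bar>D s / s\<^sup>2 - v \<bullet> (H *v u)\<bar> \<le> e' * c"
      using \<open>0 < s\<close> by simp
    also have "e' * c < e"
      using \<open>e > 0\<close> \<open>c \<ge> 0\<close> by (simp add: e'_def field_simps)
    finally show ?thesis by (simp add: dist_real_def)
  qed
  have "0 < d / (norm u + norm v + 1)"
    using \<open>d > 0\<close> by (simp add: add_nonneg_pos)
  with main have "\<forall>\<^sub>F s in at_right 0. dist (D s / s\<^sup>2) (v \<bullet> (H *v u)) < e"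
    unfolding eventually_at_right_field by blast
  then show "\<forall>\<^sub>F s in at_right 0. dist ((f (x + s *\<^sub>R u + s *\<^sub>R v) - f (x + s *\<^sub>R u)
      - f (x + s *\<^sub>R v) + f x) / s\<^sup>2) (v \<bullet> (hessian f x *v u)) < e"
    by (simp add: D_def H_def)
qed

lemma hessian_symmetric:
  fixes f :: "real^'n \<Rightarrow> real"
  assumes "twice_differentiable f"
  shows "v \<bullet> (hessian f x *v u) = u \<bullet> (hessian f x *v v)"
proof (rule tendsto_unique[OF _ second_difference_tendsto[OF assms]])
  show "((\<lambda>s. (f (x + s *\<^sub>R u + s *\<^sub>R v) - f (x + s *\<^sub>R u) - f (x + s *\<^sub>R v) + f x) / s\<^sup>2)
            \<longlongrightarrow> u \<bullet> (hessian f x *v v)) (at_right 0)"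
    using second_difference_tendsto[OF assms, of x v u] by (simp add: algebra_simps)
qed simp

section \<open>Positive definiteness of the Hessian\<close>

text \<open>Restricted to a line, \<open>f\<close> is convex, hence lies above its tangents and has an increasing derivative.\<close>

lemma hessian_nonneg:
  fixes f :: "real^'n \<Rightarrow> real"
  assumes f: "twice_differentiable f" and conv: "strictly_convex f"
  shows "0 \<le> v \<bullet> (hessian f x *v v)"
proof -
  have seg: "f ((1 - t) *\<^sub>R y + t *\<^sub>R z) \<le> (1 - t) * f y + t * f z" if "0 < t" "t < 1" for y z t
    using conv that by (cases "y = z") (auto simp: strictly_convex_def algebra_simps intro: less_imp_le)
  have line: "convex_on UNIV (\<lambda>t. f (x + t *\<^sub>R v))"
  proof (intro convex_onI)
    fix t a b :: real assume "0 < t" "t < 1"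
    have "x + ((1 - t) *\<^sub>R a + t *\<^sub>R b) *\<^sub>R v
        = (1 - t) *\<^sub>R (x + a *\<^sub>R v) + t *\<^sub>R (x + b *\<^sub>R v)"
      by (simp add: algebra_simps)
    then show "f (x + ((1 - t) *\<^sub>R a + t *\<^sub>R b) *\<^sub>R v)
        \<le> (1 - t) * f (x + a *\<^sub>R v) + t * f (x + b *\<^sub>R v)"
      using seg[OF \<open>0 < t\<close> \<open>t < 1\<close>] by simp
  qed simp
  have tangent: "v \<bullet> gradient f (x + c *\<^sub>R v) * (t - c) \<le> f (x + t *\<^sub>R v) - f (x + c *\<^sub>R v)" for c t
    using convex_on_imp_above_tangent[OF line _ _ _ DERIV_line[OF f]] by simp
  have "mono_on UNIV (\<lambda>t. v \<bullet> gradient f (x + t *\<^sub>R v))"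
  proof (rule mono_onI)
    fix s t :: real assume "s \<le> t"
    have "(v \<bullet> gradient f (x + s *\<^sub>R v) - v \<bullet> gradient f (x + t *\<^sub>R v)) * (t - s) \<le> 0"
      using tangent[of s t] tangent[of t s] by (simp add: algebra_simps)
    with \<open>s \<le> t\<close> show "v \<bullet> gradient f (x + s *\<^sub>R v) \<le> v \<bullet> gradient f (x + t *\<^sub>R v)"
      by (cases "s = t") (auto simp: mult_le_0_iff)
  qed
  from mono_on_imp_deriv_nonneg[OF this DERIV_gradient_line[OF f, of v x v 0]] show ?thesis
    by simp
qed

lemma self_concordantD:
  assumes "strongly_self_concordant f M"
  shows "v \<bullet> (hessian f y *v v) - v \<bullet> (hessian f x *v v)
           \<le> M * local_norm f z (x - y) * (v \<bullet> (hessian f w *v v))"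
  using assms
  by (auto simp: strongly_self_concordant_def loewner_le_def matrix_vector_mult_diff_rdistrib
      scaleR_matrix_vector_assoc[symmetric] inner_diff_right)

lemma local_norm_commute: "local_norm f z (x - y) = local_norm f z (y - x)"
proof -
  have "hessian f z *v (x - y) = - (hessian f z *v (y - x))"
    by (simp add: matrix_vector_mult_diff_distrib)
  then show ?thesis
    by (simp add: local_norm_def inner_diff_left)
qed

text \<open>If the quadratic form of one Hessian vanishes at \<open>v\<close>, self-concordance with that Hessian as reference
  makes it vanish at \<open>v\<close> for all Hessians.  Then \<open>f\<close> is affine in the direction \<open>v\<close>, which strict convexity
  forbids.\<close>

lemma hessian_pos:
  fixes f :: "real^'n \<Rightarrow> real"
  assumes f: "twice_differentiable f" and conv: "strictly_convex f"
    and sc: "strongly_self_concordant f M" and "v \<noteq> 0"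
  shows "0 < v \<bullet> (hessian f x *v v)"
proof (rule ccontr)
  assume "\<not> 0 < v \<bullet> (hessian f x *v v)"
  then have x: "v \<bullet> (hessian f x *v v) = 0"
    using hessian_nonneg[OF f conv, of v x] by simp
  have 0: "v \<bullet> (hessian f y *v v) = 0" for y
    using self_concordantD[OF sc, of v y x x x] x hessian_nonneg[OF f conv, of v y] by simp
  define c where "c = v \<bullet> gradient f 0"
  have "((\<lambda>t. v \<bullet> gradient f (0 + t *\<^sub>R v)) has_real_derivative 0) (at t)" for t
    using DERIV_gradient_line[OF f, of v 0 v t] by (simp only: 0)
  then have "v \<bullet> gradient f (0 + t *\<^sub>R v) = v \<bullet> gradient f (0 + 0 *\<^sub>R v)" for t
    by (intro DERIV_isconst_all[where f = "\<lambda>t. v \<bullet> gradient f (0 + t *\<^sub>R v)"]) blast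
  then have c: "v \<bullet> gradient f (0 + t *\<^sub>R v) = c" for t
    by (simp add: c_def)
  have "((\<lambda>t. f (0 + t *\<^sub>R v) - t * c) has_real_derivative 0) (at t)" for t
    using DERIV_line[OF f, of 0 v t] c[of t] by (auto intro!: derivative_eq_intros)
  then have "f (0 + s *\<^sub>R v) - s * c = f (0 + t *\<^sub>R v) - t * c" for s t
    by (intro DERIV_isconst_all[where f = "\<lambda>t. f (0 + t *\<^sub>R v) - t * c"]) blast
  from this[of "1/2" 0] this[of 1 0]
  have "f ((1/2) *\<^sub>R v) = f 0 / 2 + f v / 2"
    by simp
  moreover have "f ((1 - 1/2) *\<^sub>R 0 + (1/2) *\<^sub>R v) < (1 - 1/2) * f 0 + 1/2 * f v"
    using conv[unfolded strictly_convex_def, rule_format, of 0 v "1/2"] \<open>v \<noteq> 0\<close> by simp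
  ultimately show False by simp
qed

lemma hessian_matrix_inv:
  fixes f :: "real^'n \<Rightarrow> real"
  assumes "twice_differentiable f" "strictly_convex f" "strongly_self_concordant f M"
  shows "hessian f x *v (matrix_inv (hessian f x) *v y) = y"
proof -
  have "v = 0" if "hessian f x *v v = 0" for v
    using hessian_pos[OF assms, of v x] that by fastforce
  then have "invertible (hessian f x)"
    by (simp add: invertible_left_inverse matrix_left_invertible_ker)
  then have "hessian f x ** matrix_inv (hessian f x) = mat 1"
    unfolding invertible_def matrix_inv_def by (metis (mono_tags, lifting) someI_ex)
  then show ?thesis
    by (simp add: matrix_vector_mul_assoc)
qed

section \<open>One Newton step\<close>

text \<open>Self-concordance bounds the quadratic form of \<open>G = hessian f y - hessian f x\<close> from above, and with
  \<open>x\<close> and \<open>y\<close> exchanged from below.  Polarization and the parallelogram law for the reference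
  quadratic form turn this into a bound for the bilinear form on unit vectors, and homogeneity does the
  rest.\<close>

lemma hessian_difference_bilinear_le:
  fixes f :: "real^'n \<Rightarrow> real"
  assumes f: "twice_differentiable f" and conv: "strictly_convex f"
    and sc: "strongly_self_concordant f M"
  shows "v \<bullet> ((hessian f y - hessian f x) *v d)
           \<le> M * local_norm f z (x - y) * (local_norm f w v * local_norm f w d)"
proof (cases "v = 0 \<or> d = 0")
  case True
  then show ?thesis by (auto simp: local_norm_def)
next
  case False
  define Q where "Q u = u \<bullet> (hessian f w *v u)" for u
  define G where "G = hessian f y - hessian f x"
  define a where "a = M * local_norm f z (x - y)"
  define p where "p = local_norm f w v"
  define q where "q = local_norm f w d"
  have "p > 0" "q > 0" and pq: "p\<^sup>2 = Q v" "q\<^sup>2 = Q d"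
    using False hessian_pos[OF f conv sc] by (auto simp: p_def q_def Q_def local_norm_def less_imp_le)
  have sym: "s \<bullet> (hessian f w *v t) = t \<bullet> (hessian f w *v s)"
    "s \<bullet> (G *v t) = t \<bullet> (G *v s)" for s t
    using hessian_symmetric[OF f]
    by (simp_all add: G_def matrix_vector_mult_diff_rdistrib inner_diff_right)
  have up: "u \<bullet> (G *v u) \<le> a * Q u" for u
    using self_concordantD[OF sc, of u y x z w]
    by (simp add: G_def a_def Q_def matrix_vector_mult_diff_rdistrib inner_diff_right)
  have lo: "- (u \<bullet> (G *v u)) \<le> a * Q u" for u
    using self_concordantD[OF sc, of u x y z w]
    by (simp add: G_def a_def Q_def matrix_vector_mult_diff_rdistrib inner_diff_right
        local_norm_commute[of f z x y])
  have unit: "s \<bullet> (G *v t) \<le> a" if "Q s = 1" "Q t = 1" for s t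
  proof -
    have "4 * (s \<bullet> (G *v t)) = (s + t) \<bullet> (G *v (s + t)) - (s - t) \<bullet> (G *v (s - t))"
      by (simp add: matrix_vector_right_distrib matrix_vector_mult_diff_distrib inner_diff_right
          inner_diff_left inner_add_left inner_add_right sym(2)[of t s])
    also have "\<dots> \<le> a * (Q (s + t) + Q (s - t))"
      using up[of "s + t"] lo[of "s - t"] by (simp add: distrib_left)
    also have "Q (s + t) + Q (s - t) = 2 * Q s + 2 * Q t"
      by (simp add: Q_def matrix_vector_right_distrib matrix_vector_mult_diff_distrib inner_diff_right
          inner_diff_left inner_add_left inner_add_right sym(1)[of t s])
    finally show ?thesis using that by simp
  qed
  have scale: "Q (c *\<^sub>R u) = c\<^sup>2 * Q u" for c u
    by (simp add: Q_def matrix_vector_mult_scaleR power2_eq_square)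
  have "(inverse p *\<^sub>R v) \<bullet> (G *v (inverse q *\<^sub>R d)) \<le> a"
    using \<open>p > 0\<close> \<open>q > 0\<close> by (intro unit) (simp_all add: scale pq[symmetric] power_inverse)
  then show ?thesis
    using \<open>p > 0\<close> \<open>q > 0\<close>
    by (simp add: matrix_vector_mult_scaleR field_simps G_def[symmetric] a_def[symmetric]
        p_def[symmetric] q_def[symmetric])
qed

text \<open>The decrement, defined by the dual norm of the gradient, is the primal local norm of the Newton step.\<close>

lemma newton_decrement_eq:
  fixes f :: "real^'n \<Rightarrow> real"
  assumes "twice_differentiable f" "strictly_convex f" "strongly_self_concordant f M"
  shows "newton_decrement f x = local_norm f x (matrix_inv (hessian f x) *v gradient f x)"
  by (simp add: newton_decrement_def dual_local_norm_def local_norm_def hessian_matrix_inv[OF assms]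
      inner_commute)

lemma newton_decrement_nonneg:
  fixes f :: "real^'n \<Rightarrow> real"
  assumes "twice_differentiable f" "strictly_convex f" "strongly_self_concordant f M"
  shows "0 \<le> newton_decrement f x"
  using hessian_nonneg[OF assms(1,2)] by (simp add: newton_decrement_eq[OF assms] local_norm_def)

lemma newton_decrement_step:
  fixes f :: "real^'n \<Rightarrow> real"
  assumes f: "twice_differentiable f" and conv: "strictly_convex f"
    and sc: "strongly_self_concordant f M"
    and y: "y = x - matrix_inv (hessian f x) *v gradient f x"
  shows "newton_decrement f y
           \<le> sqrt (1 + M * newton_decrement f x) / 2 * M * (newton_decrement f x)\<^sup>2"
proof -
  note as = f conv sc
  have "M > 0" using sc by (simp add: strongly_self_concordant_def)
  define l where "l = newton_decrement f x"
  define m where "m = newton_decrement f y"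
  define d where "d = y - x"
  define v where "v = matrix_inv (hessian f y) *v gradient f y"
  have d: "d = - (matrix_inv (hessian f x) *v gradient f x)"
    by (simp add: d_def y)
  have "l \<ge> 0" "m \<ge> 0"
    by (simp_all add: l_def m_def newton_decrement_nonneg[OF as])
  have neg: "local_norm f z (- u) = local_norm f z u" for z u
    using local_norm_commute[of f z 0 u] by simp
  have ld: "local_norm f x d = l"
    by (simp add: d neg l_def newton_decrement_eq[OF as])
  have mv: "local_norm f y v = m"
    by (simp add: v_def m_def newton_decrement_eq[OF as])
  have sq: "(local_norm f z u)\<^sup>2 = u \<bullet> (hessian f z *v u)" for z u
    using hessian_nonneg[OF f conv] by (simp add: local_norm_def)
  have Hd: "hessian f x *v d = - gradient f x"
    by (simp add: d hessian_matrix_inv[OF as] vec.neg)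
  have m2: "m\<^sup>2 = v \<bullet> gradient f y"
    using sq[of y v] by (simp add: mv) (simp add: v_def hessian_matrix_inv[OF as])
  \<comment> \<open>Instead of integrating \<open>v \<bullet> (H\<^sub>t - H) d \<le> K * t\<close> over \<open>t\<close> in \<open>[0, 1]\<close>, the difference of the
      antiderivatives \<open>\<phi>\<close> is shown to be decreasing.\<close>
  define K where "K = M * l * (m * local_norm f y d)"
  define \<phi> where "\<phi> t = v \<bullet> gradient f (x + t *\<^sub>R d) - t * (v \<bullet> (hessian f x *v d)) - K * t\<^sup>2 / 2" for t
  have "\<phi> 1 \<le> \<phi> 0"
  proof (rule DERIV_nonpos_imp_nonincreasing[where f = \<phi>])
    fix t :: real assume t: "0 \<le> t"
    have "(\<phi> has_real_derivative v \<bullet> (hessian f (x + t *\<^sub>R d) *v d) - v \<bullet> (hessian f x *v d) - K * t) (at t)"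
      unfolding \<phi>_def
      by (auto intro!: derivative_eq_intros DERIV_gradient_line[OF f])
    moreover have "v \<bullet> (hessian f (x + t *\<^sub>R d) *v d) - v \<bullet> (hessian f x *v d) \<le> K * t"
    proof -
      have "local_norm f x (x - (x + t *\<^sub>R d)) = t * l"
        using t by (simp add: neg) (simp add: local_norm_def matrix_vector_mult_scaleR
            real_sqrt_mult ld[unfolded local_norm_def])
      then show ?thesis
        using hessian_difference_bilinear_le[OF as, of v "x + t *\<^sub>R d" x d x y]
        by (simp add: mv K_def matrix_vector_mult_diff_rdistrib inner_diff_right algebra_simps)
    qed
    ultimately show "\<exists>y. (\<phi> has_real_derivative y) (at t) \<and> y \<le> 0" by force
  qed simp
  then have "v \<bullet> gradient f y \<le> K / 2"
    by (simp add: \<phi>_def Hd) (simp add: d_def)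
  then have "m * m \<le> m * (M * l / 2 * local_norm f y d)"
    using m2 by (simp add: K_def power2_eq_square algebra_simps)
  moreover have "0 \<le> local_norm f y d"
    using hessian_nonneg[OF f conv] by (simp add: local_norm_def)
  ultimately have 1: "m \<le> M * l / 2 * local_norm f y d"
    using \<open>m \<ge> 0\<close> \<open>l \<ge> 0\<close> \<open>M > 0\<close> by (cases "m = 0") (simp_all add: mult_le_cancel_left)
  have "(local_norm f y d)\<^sup>2 \<le> l\<^sup>2 + M * l * l\<^sup>2"
    using self_concordantD[OF sc, of d y x x x] ld sq[of x d] sq[of y d]
    by (simp add: local_norm_commute[of f x x y] d_def[symmetric])
  also have "\<dots> = (1 + M * l) * l\<^sup>2"
    by (simp add: algebra_simps)
  finally have "local_norm f y d \<le> sqrt ((1 + M * l) * l\<^sup>2)"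
    by (rule real_le_rsqrt)
  also have "\<dots> = sqrt (1 + M * l) * l"
    using \<open>l \<ge> 0\<close> by (simp add: real_sqrt_mult)
  finally have "M * l / 2 * local_norm f y d \<le> M * l / 2 * (sqrt (1 + M * l) * l)"
    using \<open>l \<ge> 0\<close> \<open>M > 0\<close> by (intro mult_left_mono) auto
  with 1 show ?thesis
    by (simp add: l_def m_def power2_eq_square algebra_simps)
qed

section \<open>Quadratic convergence\<close>

lemma contraction_factor_less_1: "sqrt (1 + 131 / 100) / 2 * (131 / 100) < (1::real)"
proof -
  have "sqrt (1 + 131 / 100) < (200 / 131 :: real)"
    by (rule real_less_lsqrt) (simp_all add: power2_eq_square)
  then show ?thesis by simp
qed

theorem mainTheorem3:
  fixes f :: "real^'n \<Rightarrow> real"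
    and M :: real
    and xstar :: "real^'n"
    and x :: "nat \<Rightarrow> real^'n"
    and k :: nat
  assumes "twice_differentiable f"
    and "strictly_convex f"
    and "bdd_below (range f)"
    and "\<forall>y. f xstar \<le> f y"
    and "M > 0"
    and "strongly_self_concordant f M"
    and "newton_sequence f x"
    and "newton_decrement f (x k) \<le> 131 / (100 * M)"
  shows "converges_quadratically (\<lambda>j. newton_decrement f (x (k + j)))
    \<and> newton_decrement f (x (Suc k))
        \<le> sqrt (1 + M * newton_decrement f (x k)) / 2 * M * (newton_decrement f (x k))\<^sup>2
    \<and> sqrt (1 + M * newton_decrement f (x k)) / 2 * M * (newton_decrement f (x k))\<^sup>2
        \<le> sqrt (1 + 131 / 100) / 2 * (131 / 100) * newton_decrement f (x k)
    \<and> (newton_decrement f (x k) \<noteq> 0 \<longrightarrow>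
        sqrt (1 + 131 / 100) / 2 * (131 / 100) * newton_decrement f (x k)
          < newton_decrement f (x k))"
proof -
  define l where "l j = newton_decrement f (x j)" for j
  define q where "q = sqrt (1 + 131 / 100) / 2 * (131 / 100 :: real)"
  have q: "0 \<le> q" "q < 1"
    using contraction_factor_less_1 by (simp_all add: q_def)
  have l0: "0 \<le> l j" for j
    using newton_decrement_nonneg assms by (simp add: l_def)
  have step: "l (Suc j) \<le> sqrt (1 + M * l j) / 2 * M * (l j)\<^sup>2" for j
    using newton_decrement_step[OF assms(1,2,6)] assms(7) by (simp add: l_def newton_sequence_def)
  have quad: "sqrt (1 + M * l j) / 2 * M * (l j)\<^sup>2 \<le> sqrt (1 + 131 / 100) / 2 * M * (l j)\<^sup>2"
    if "M * l j \<le> 131 / 100" for j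
    using that \<open>M > 0\<close> by (intro mult_right_mono divide_right_mono) auto
  have lin: "sqrt (1 + 131 / 100) / 2 * M * (l j)\<^sup>2 \<le> q * l j" if "M * l j \<le> 131 / 100" for j
  proof -
    have "sqrt (1 + 131 / 100) / 2 * (M * l j) * l j \<le> sqrt (1 + 131 / 100) / 2 * (131 / 100) * l j"
      using that l0[of j] by (intro mult_right_mono mult_left_mono) auto
    then show ?thesis by (simp add: q_def power2_eq_square algebra_simps)
  qed
  have start: "M * l k \<le> 131 / 100"
    using assms(8) \<open>M > 0\<close> by (simp add: l_def field_simps)
  have geo: "l (k + j) \<le> q ^ j * l k \<and> M * l (k + j) \<le> 131 / 100" for j
  proof (induction j)
    case 0
    then show ?case using start by simp
  next
    case (Suc j)
    then have le: "l (k + Suc j) \<le> q * l (k + j)"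
      using step[of "k + j"] quad[of "k + j"] lin[of "k + j"] by simp
    also have "\<dots> \<le> q * (q ^ j * l k)"
      using Suc q by (intro mult_left_mono) auto
    finally have "l (k + Suc j) \<le> q ^ Suc j * l k" by simp
    moreover have "l (k + Suc j) \<le> l (k + j)"
      using le mult_right_mono[of q 1 "l (k + j)"] q l0[of "k + j"] by simp
    then have "M * l (k + Suc j) \<le> M * l (k + j)"
      using \<open>M > 0\<close> by simp
    ultimately show ?case using Suc by simp
  qed
  have "(\<lambda>j. q ^ j * l k) \<longlonglongrightarrow> 0"
    using q by (intro tendsto_mult_left_zero LIMSEQ_power_zero) auto
  then have "(\<lambda>j. l (k + j)) \<longlonglongrightarrow> 0"
    by (rule tendsto_sandwich[OF _ _ tendsto_const, rotated 2]) (use geo l0 in auto)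
  moreover have "l (k + Suc j) \<le> (sqrt (1 + 131 / 100) / 2 * M) * (l (k + j))\<^sup>2" for j
    using step[of "k + j"] quad[of "k + j"] geo[of j] by simp
  moreover have "sqrt (1 + 131 / 100) / 2 * M > 0"
    using \<open>M > 0\<close> by simp
  ultimately have "converges_quadratically (\<lambda>j. l (k + j))"
    unfolding converges_quadratically_def by blast
  moreover have "q * l k < l k" if "l k \<noteq> 0"
    using that l0[of k] q by simp
  moreover have "sqrt (1 + M * l k) / 2 * M * (l k)\<^sup>2 \<le> q * l k"
    using quad[OF start] lin[OF start] by (rule order_trans)
  ultimately show ?thesis
    using step[of k] unfolding q_def l_def by blast
qed

end
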